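(* For all integers $m,n\geq 1$, the lattice grid graph $P_1[m+1]\times P_2[n+1]$ is antimagic.
   Context: All graphs are finite, undirected and simple. For an integer $k\geq 1$, $P[k]$ (also written $P_1[k]$, $P_2[k]$) denotes the path on $k$ vertices. The Cartesian product $G_1\times G_2$ of graphs $G_1=(V_1,E_1)$ and $G_2=(V_2,E_2)$ has vertex set $V_1\times V_2$, with $(u_1,u_2)$ adjacent to $(v_1,v_2)$ iff either $u_1=v_1$ and $u_2v_2\in E_2$, or $u_2=v_2$ and $u_1v_1\in E_1$. An antimagic labeling of a graph with $m'$ edges is a bijection $f$ from its edge set to $\{1,\ldots,m'\}$ such that the vertex sums $f^+(v)=\sum_{e\ni v} f(e)$ (sum over edges incident with $v$) are pairwise distinct over all vertices $v$. A graph is antimagic if it admits an antimagic labeling. *)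

theory Defs
  imports Main
begin

definition simple_graph :: "'a set \<Rightarrow> 'a set set \<Rightarrow> bool" where
  "simple_graph V E \<longleftrightarrow> finite V \<and> (\<forall>e\<in>E. e \<subseteq> V \<and> card e = 2)"

definition vertex_sum :: "'a set set \<Rightarrow> ('a set \<Rightarrow> nat) \<Rightarrow> 'a \<Rightarrow> nat" where
  "vertex_sum E f v = (\<Sum>e\<in>{e\<in>E. v \<in> e}. f e)"

definition antimagic_labeling :: "'a set \<Rightarrow> 'a set set \<Rightarrow> ('a set \<Rightarrow> nat) \<Rightarrow> bool" where
  "antimagic_labeling V E f \<longleftrightarrow>
     bij_betw f E {1..card E} \<and> inj_on (vertex_sum E f) V"

definition antimagic :: "'a set \<Rightarrow> 'a set set \<Rightarrow> bool" where
  "antimagic V E \<longleftrightarrow> (\<exists>f. antimagic_labeling V E f)"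

definition path_vertices :: "nat \<Rightarrow> nat set" where
  "path_vertices k = {0..<k}"

definition path_edges :: "nat \<Rightarrow> nat set set" where
  "path_edges k = {{i, i+1} | i. i + 1 < k}"

definition cart_vertices :: "'a set \<Rightarrow> 'b set \<Rightarrow> ('a \<times> 'b) set" where
  "cart_vertices V1 V2 = V1 \<times> V2"

definition cart_edges ::
  "'a set \<Rightarrow> 'a set set \<Rightarrow> 'b set \<Rightarrow> 'b set set \<Rightarrow> ('a \<times> 'b) set set" where
  "cart_edges V1 E1 V2 E2 =
     {{(u1, u2), (v1, v2)} | u1 u2 v1 v2.
        u1 \<in> V1 \<and> v1 \<in> V1 \<and> u2 \<in> V2 \<and> v2 \<in> V2 \<and>
        ((u1 = v1 \<and> {u2, v2} \<in> E2) \<or> (u2 = v2 \<and> {u1, v1} \<in> E1))}"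

end

theory Submission
  imports Defs
begin

text \<open>
  If \<open>m = n = 1\<close> the grid is a 4-cycle, and transposing the grid otherwise allows \<open>m \<ge> 2\<close>. The
  smallest labels go to the vertical edges of the two outer columns, the next ones to the
  horizontal edges, the largest ones to the remaining vertical edges. Rows are taken in
  the order \<open>0, m, 1, m - 1, 2, \<dots>\<close>, from the outside inwards, and so are the layers of vertical
  edges between consecutive rows; within a row or layer the labels increase from left to right.
  Then the sums in the outer columns are smaller than all others and increase with the position
  of the row, and at the inner vertices the sums grow with the position of the row because every
  label at a vertex is dominated by a label from a later block. The one exception is the
  innermost layer, which the last two rows share: its labels decrease from left to right, so that
  they cannot offset the gain in the horizontal labels.
\<close>

section \<open>Edges of the grid, indexed by row and column\<close>

definition vedge :: "nat \<Rightarrow> nat \<Rightarrow> (nat \<times> nat) set" where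
  "vedge i j = {(i, j), (Suc i, j)}"

definition hedge :: "nat \<Rightarrow> nat \<Rightarrow> (nat \<times> nat) set" where
  "hedge i j = {(i, j), (i, Suc j)}"

abbreviation grid_vertices :: "nat \<Rightarrow> nat \<Rightarrow> (nat \<times> nat) set" where
  "grid_vertices m n \<equiv> cart_vertices (path_vertices (m + 1)) (path_vertices (n + 1))"

abbreviation grid_edges :: "nat \<Rightarrow> nat \<Rightarrow> (nat \<times> nat) set set" where
  "grid_edges m n \<equiv> cart_edges (path_vertices (m + 1)) (path_edges (m + 1))
                       (path_vertices (n + 1)) (path_edges (n + 1))"

lemma vedge_eq_iff [simp]: "vedge i j = vedge i' j' \<longleftrightarrow> i = i' \<and> j = j'"
  by (auto simp: vedge_def doubleton_eq_iff)

lemma hedge_eq_iff [simp]: "hedge i j = hedge i' j' \<longleftrightarrow> i = i' \<and> j = j'"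
  by (auto simp: hedge_def doubleton_eq_iff)

lemma vedge_neq_hedge [simp]: "vedge i j \<noteq> hedge i' j'" "hedge i' j' \<noteq> vedge i j"
  by (auto simp: vedge_def hedge_def doubleton_eq_iff)

lemma grid_edges_eq:
  "grid_edges m n = case_prod vedge ` ({..<m} \<times> {..n}) \<union> case_prod hedge ` ({..m} \<times> {..<n})"
    (is "_ = ?R")
proof
  show "grid_edges m n \<subseteq> ?R"
  proof
    fix e assume "e \<in> grid_edges m n"
    then obtain u1 u2 v1 v2 where e: "e = {(u1, u2), (v1, v2)}"
      and le: "u1 \<le> m" "v1 \<le> m" "u2 \<le> n" "v2 \<le> n"
      and adj: "(u1 = v1 \<and> {u2, v2} \<in> path_edges (n + 1)) \<or> (u2 = v2 \<and> {u1, v1} \<in> path_edges (m + 1))"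
      by (auto simp: cart_edges_def path_vertices_def)
    from adj show "e \<in> ?R"
    proof
      assume "u1 = v1 \<and> {u2, v2} \<in> path_edges (n + 1)"
      then obtain j where "u1 = v1" "j < n" "{u2, v2} = {j, Suc j}"
        by (auto simp: path_edges_def)
      then have "e = hedge u1 j"
        using e by (auto simp: hedge_def doubleton_eq_iff)
      then show ?thesis using \<open>j < n\<close> le by auto
    next
      assume "u2 = v2 \<and> {u1, v1} \<in> path_edges (m + 1)"
      then obtain i where "u2 = v2" "i < m" "{u1, v1} = {i, Suc i}"
        by (auto simp: path_edges_def)
      then have "e = vedge i u2"
        using e by (auto simp: vedge_def doubleton_eq_iff)
      then show ?thesis using \<open>i < m\<close> le by auto
    qed
  qed
next
  have "vedge i j \<in> grid_edges m n" if "i < m" "j \<le> n" for i j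
    unfolding cart_edges_def vedge_def path_vertices_def path_edges_def
    using that by (intro CollectI exI[of _ i] exI[of _ j] exI[of _ "Suc i"]) auto
  moreover have "hedge i j \<in> grid_edges m n" if "i \<le> m" "j < n" for i j
    unfolding cart_edges_def hedge_def path_vertices_def path_edges_def
    using that by (intro CollectI exI[of _ i] exI[of _ j] exI[of _ "Suc j"]) auto
  ultimately show "?R \<subseteq> grid_edges m n" by auto
qed

section \<open>Antimagic labelings in coordinates\<close>

definition grid_sum ::
  "nat \<Rightarrow> nat \<Rightarrow> (nat \<Rightarrow> nat \<Rightarrow> nat) \<Rightarrow> (nat \<Rightarrow> nat \<Rightarrow> nat) \<Rightarrow> nat \<Rightarrow> nat \<Rightarrow> nat" where
  "grid_sum m n a h i j =
     (if 0 < i then a (i - 1) j else 0) + (if i < m then a i j else 0) +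
     ((if 0 < j then h i (j - 1) else 0) + (if j < n then h i j else 0))"

text \<open>\<open>a i j\<close> is to label \<open>vedge i j\<close> and \<open>h i j\<close> is to
  label \<open>hedge i j\<close>. The upper bound is the number of edges, so surjectivity will
  follow from injectivity by counting.\<close>

locale grid_labeling =
  fixes m n :: nat and a h :: "nat \<Rightarrow> nat \<Rightarrow> nat"
  assumes a_bounds: "\<lbrakk>i < m; j \<le> n\<rbrakk> \<Longrightarrow> a i j \<in> {1..m * (n + 1) + (m + 1) * n}"
    and h_bounds: "\<lbrakk>i \<le> m; j < n\<rbrakk> \<Longrightarrow> h i j \<in> {1..m * (n + 1) + (m + 1) * n}"
    and a_inject: "\<lbrakk>i < m; j \<le> n; i' < m; j' \<le> n; a i j = a i' j'\<rbrakk> \<Longrightarrow> i = i' \<and> j = j'"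
    and h_inject: "\<lbrakk>i \<le> m; j < n; i' \<le> m; j' < n; h i j = h i' j'\<rbrakk> \<Longrightarrow> i = i' \<and> j = j'"
    and a_neq_h: "\<lbrakk>i < m; j \<le> n; i' \<le> m; j' < n\<rbrakk> \<Longrightarrow> a i j \<noteq> h i' j'"
    and sum_inject: "\<lbrakk>i \<le> m; j \<le> n; i' \<le> m; j' \<le> n;
      grid_sum m n a h i j = grid_sum m n a h i' j'\<rbrakk> \<Longrightarrow> i = i' \<and> j = j'"

text \<open>Transposition exchanges vertical and horizontal edges and keeps each vertex sum, so only
  one of the two side lengths has to be large.\<close>

lemma grid_labeling_swap:
  assumes "grid_labeling m n a h"
  shows "grid_labeling n m (\<lambda>i j. h j i) (\<lambda>i j. a j i)"
proof -
  interpret grid_labeling m n a h by fact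
  have sum: "grid_sum n m (\<lambda>i j. h j i) (\<lambda>i j. a j i) i j = grid_sum m n a h j i" for i j
    by (simp add: grid_sum_def)
  have edges: "n * (m + 1) + (n + 1) * m = m * (n + 1) + (m + 1) * n"
    by (simp add: algebra_simps)
  show ?thesis
  proof (unfold_locales, goal_cases)
    case 1
    then show ?case unfolding edges by (intro h_bounds)
  next
    case 2
    then show ?case unfolding edges by (intro a_bounds)
  next
    case 3
    then show ?case using h_inject by blast
  next
    case 4
    then show ?case using a_inject by blast
  next
    case 5
    then show ?case using a_neq_h by metis
  next
    case 6
    then show ?case unfolding sum using sum_inject by blast
  qed
qed

lemma incident_edges:
  assumes "i \<le> m" "j \<le> n"
  shows "{e \<in> grid_edges m n. (i, j) \<in> e} =
    (if 0 < i then {vedge (i - 1) j} else {}) \<union> (if i < m then {vedge i j} else {}) \<union>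
    ((if 0 < j then {hedge i (j - 1)} else {}) \<union> (if j < n then {hedge i j} else {}))"
proof -
  have "(i, j) \<in> vedge i' j' \<longleftrightarrow> j' = j \<and> (i = Suc i' \<or> i' = i)" for i' j'
    by (auto simp: vedge_def)
  then have "{e \<in> case_prod vedge ` ({..<m} \<times> {..n}). (i, j) \<in> e} =
      (if 0 < i then {vedge (i - 1) j} else {}) \<union> (if i < m then {vedge i j} else {})"
    using assms by (cases i) auto
  moreover have "(i, j) \<in> hedge i' j' \<longleftrightarrow> i' = i \<and> (j = Suc j' \<or> j' = j)" for i' j'
    by (auto simp: hedge_def)
  then have "{e \<in> case_prod hedge ` ({..m} \<times> {..<n}). (i, j) \<in> e} =
      (if 0 < j then {hedge i (j - 1)} else {}) \<union> (if j < n then {hedge i j} else {})"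
    using assms by (cases j) auto
  moreover have "{e \<in> A \<union> H. P e} = {e \<in> A. P e} \<union> {e \<in> H. P e}" for A H :: "(nat \<times> nat) set set" and P
    by blast
  ultimately show ?thesis by (simp only: grid_edges_eq)
qed

lemma (in grid_labeling) antimagic_grid:
  "antimagic (grid_vertices m n) (grid_edges m n)"
proof -
  \<comment> \<open>An edge is decoded from its projections: \<open>fst\<close> takes two values on
    a vertical edge and one on a horizontal edge, and the minima recover \<open>i\<close> and
    \<open>j\<close>.\<close>
  define f where "f e = (if card (fst ` e) = 2 then a (Min (fst ` e)) (Min (snd ` e))
                         else h (Min (fst ` e)) (Min (snd ` e)))" for e :: "(nat \<times> nat) set"
  have f_vedge [simp]: "f (vedge i j) = a i j" for i j
    by (simp add: f_def vedge_def)
  have f_hedge [simp]: "f (hedge i j) = h i j" for i j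
    by (simp add: f_def hedge_def)
  let ?A = "case_prod vedge ` ({..<m} \<times> {..n})" and ?H = "case_prod hedge ` ({..m} \<times> {..<n})"
  have "card (grid_edges m n) = card ?A + card ?H"
    unfolding grid_edges_eq by (rule card_Un_disjoint) auto
  also have "card ?A = m * (n + 1)"
    by (subst card_image) (auto simp: inj_on_def)
  also have "card ?H = (m + 1) * n"
    by (subst card_image) (auto simp: inj_on_def)
  finally have card: "card (grid_edges m n) = m * (n + 1) + (m + 1) * n" .
  have inj: "inj_on f (grid_edges m n)"
    unfolding grid_edges_eq inj_on_Un
  proof (intro conjI)
    show "inj_on f ?A"
      by (rule inj_onI) (clarsimp, rule a_inject, simp_all)
    show "inj_on f ?H"
      by (rule inj_onI) (clarsimp, rule h_inject, simp_all)
    show "f ` (?A - ?H) \<inter> f ` (?H - ?A) = {}"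
      using a_neq_h by fastforce
  qed
  have sub: "f ` grid_edges m n \<subseteq> {1..card (grid_edges m n)}"
  proof (rule image_subsetI)
    fix e assume "e \<in> grid_edges m n"
    then consider i j where "e = vedge i j" "i < m" "j \<le> n" | i j where "e = hedge i j" "i \<le> m" "j < n"
      unfolding grid_edges_eq by auto
    then show "f e \<in> {1..card (grid_edges m n)}"
      unfolding card by cases (simp_all only: f_vedge f_hedge a_bounds h_bounds)
  qed
  \<comment> \<open>An injective image inside a finite set of the same size is the whole
    set.\<close>
  have "f ` grid_edges m n = {1..card (grid_edges m n)}"
    using card_image[OF inj] by (intro card_subset_eq finite_atLeastAtMost sub) simp
  with inj have bij: "bij_betw f (grid_edges m n) {1..card (grid_edges m n)}"
    by (rule bij_betw_imageI)
  have "vertex_sum (grid_edges m n) f (i, j) = grid_sum m n a h i j"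
    if "i \<le> m" "j \<le> n" for i j
    unfolding vertex_sum_def incident_edges[OF that] grid_sum_def
    by (cases "0 < i"; cases "i < m"; cases "0 < j"; cases "j < n"; simp)
  moreover have "grid_vertices m n = {..m} \<times> {..n}"
    by (auto simp: cart_vertices_def path_vertices_def)
  ultimately have "inj_on (vertex_sum (grid_edges m n) f) (grid_vertices m n)"
    using sum_inject by (auto intro!: inj_onI)
  with bij show ?thesis
    unfolding antimagic_def antimagic_labeling_def by blast
qed

section \<open>Labels in terms of the positions of rows and layers\<close>

text \<open>
  Position of the \<open>i\<close>-th element in the enumeration \<open>0, m, 1, m - 1, \<dots>\<close> of \<open>{0..m}\<close>. The layer
  of vertical edges between rows \<open>i\<close> and \<open>i + 1\<close> has position \<open>outer_pos (m - 1) i\<close>.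
\<close>

definition outer_pos :: "nat \<Rightarrow> nat \<Rightarrow> nat" where
  "outer_pos m i = (if 2 * i \<le> m then 2 * i else 2 * (m - i) + 1)"

lemma outer_pos_le: "i \<le> m \<Longrightarrow> outer_pos m i \<le> m"
  by (auto simp: outer_pos_def)

lemma outer_pos_eq_iff:
  "i \<le> m \<Longrightarrow> i' \<le> m \<Longrightarrow> outer_pos m i = outer_pos m i' \<longleftrightarrow> i = i'"
  unfolding outer_pos_def by (auto; presburger)

text \<open>
  The layer in position \<open>q\<close> joins the rows in positions \<open>q\<close> and \<open>q + 2\<close>, except that the last
  layer, \<open>q = m - 1\<close>, joins those in positions \<open>m - 1\<close> and \<open>m\<close>.
\<close>

definition layer_sum :: "nat \<Rightarrow> (nat \<Rightarrow> nat) \<Rightarrow> nat \<Rightarrow> nat" where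
  "layer_sum m g t =
     (if t < m then g t + (if 2 \<le> t then g (t - 2) else 0) else g (m - 1) + g (m - 2))"

lemma layer_sum_outer_pos:
  fixes g :: "nat \<Rightarrow> nat"
  assumes "i \<le> m" "2 \<le> m"
  defines "t \<equiv> outer_pos m i"
  shows "(if 0 < i then g (outer_pos (m - 1) (i - 1)) else 0) +
         (if i < m then g (outer_pos (m - 1) i) else 0) = layer_sum m g t"
proof -
  \<comment> \<open>The outer cases are the even and the odd positions below \<open>m\<close>. The
    two middle cases are the last row, \<open>t = m\<close>, for even and odd \<open>m\<close>; the
    innermost layer, in position \<open>m - 1\<close>, then follows or precedes row
    \<open>i\<close>.\<close>
  consider "2 * i < m" | "2 * i = m" | "2 * i = m + 1" | "m + 1 < 2 * i" by linarith
  then show ?thesis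
  proof cases
    case 1
    then have "t = 2 * i" "outer_pos (m - 1) i = 2 * i" "outer_pos (m - 1) (i - 1) = 2 * i - 2"
      by (auto simp: t_def outer_pos_def)
    with 1 show ?thesis by (auto simp: layer_sum_def)
  next
    case 2
    then have "t = m" "outer_pos (m - 1) i = m - 1" "outer_pos (m - 1) (i - 1) = m - 2"
      using assms by (auto simp: t_def outer_pos_def)
    with 2 assms show ?thesis by (auto simp: layer_sum_def)
  next
    case 3
    then have "t = m" "outer_pos (m - 1) i = m - 2" "outer_pos (m - 1) (i - 1) = m - 1"
      using assms by (auto simp: t_def outer_pos_def)
    with 3 assms show ?thesis by (auto simp: layer_sum_def)
  next
    case 4
    then have "t = 2 * (m - i) + 1" "outer_pos (m - 1) (i - 1) = t"
      "i < m \<Longrightarrow> outer_pos (m - 1) i = t - 2"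
      using assms by (auto simp: t_def outer_pos_def)
    moreover from this 4 assms have "t < m" "i < m \<longleftrightarrow> 2 \<le> t" by auto
    ultimately show ?thesis using 4 by (simp add: layer_sum_def)
  qed
qed

text \<open>Here \<open>q\<close> is the position of a layer. The outer columns use
  \<open>1..2 * m\<close>, odd on the left and even on the right. The inner columns start after the
  \<open>(m + 1) * n\<close> horizontal labels, in runs of \<open>n - 1\<close> per layer;
  \<open>n - j\<close> reverses the last run.\<close>

definition vlabel :: "nat \<Rightarrow> nat \<Rightarrow> nat \<Rightarrow> nat \<Rightarrow> nat" where
  "vlabel m n q j =
     (if j = 0 then 2 * q + 1 else if j = n then 2 * q + 2
      else 2 * m + (m + 1) * n + q * (n - 1) + (if q = m - 1 then n - j else j))"

definition hlabel :: "nat \<Rightarrow> nat \<Rightarrow> nat \<Rightarrow> nat \<Rightarrow> nat" where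
  "hlabel m n t j = 2 * m + t * n + j + 1"

definition pos_sum :: "nat \<Rightarrow> nat \<Rightarrow> nat \<Rightarrow> nat \<Rightarrow> nat" where
  "pos_sum m n t j =
     layer_sum m (\<lambda>q. vlabel m n q j) t +
     ((if 0 < j then hlabel m n t (j - 1) else 0) + (if j < n then hlabel m n t j else 0))"

lemma block_le: "(t::nat) < t' \<Longrightarrow> t * k + k \<le> t' * k"
  by (metis Suc_leI add.commute mult_Suc mult_le_mono1)

lemma hlabel_mono: "t < t' \<Longrightarrow> j < n \<Longrightarrow> hlabel m n t j < hlabel m n t' j'"
  using block_le[of t t' n] by (simp add: hlabel_def)

lemma vlabel_inner_block:
  assumes "0 < j" "j < n"
  shows "2 * m + (m + 1) * n + q * (n - 1) < vlabel m n q j"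
    and "vlabel m n q j \<le> 2 * m + (m + 1) * n + (q * (n - 1) + (n - 1))"
proof -
  have "vlabel m n q j = 2 * m + (m + 1) * n + q * (n - 1) + (if q = m - 1 then n - j else j)"
    using assms by (simp add: vlabel_def)
  \<comment> \<open>Both orientations of a layer stay within the same run, so comparisons between
    different layers need not distinguish them.\<close>
  moreover have "(if q = m - 1 then n - j else j) \<in> {1..n - 1}"
    using assms by auto
  ultimately show "2 * m + (m + 1) * n + q * (n - 1) < vlabel m n q j"
    and "vlabel m n q j \<le> 2 * m + (m + 1) * n + (q * (n - 1) + (n - 1))"
    unfolding atLeastAtMost_iff by linarith+
qed

lemma vlabel_inner_mono:
  assumes "q < q'" "0 < j" "j < n" "0 < j'" "j' < n"
  shows "vlabel m n q j < vlabel m n q' j'"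
  using block_le[OF \<open>q < q'\<close>, of "n - 1"] vlabel_inner_block(2)[of j n m q]
    vlabel_inner_block(1)[of j' n m q'] assms by linarith

lemma vlabel_outer_le: "q < m \<Longrightarrow> j = 0 \<or> j = n \<Longrightarrow> vlabel m n q j \<le> 2 * m"
  by (auto simp: vlabel_def)

lemma vlabel_inner_gt: "0 < j \<Longrightarrow> j < n \<Longrightarrow> 2 * m + (m + 1) * n < vlabel m n q j"
  by (auto simp: vlabel_def)

lemma vlabel_bounds:
  assumes "q < m" "j \<le> n" "1 \<le> n"
  shows "vlabel m n q j \<in> {1..m * (n + 1) + (m + 1) * n}"
proof (cases "j = 0 \<or> j = n")
  case True
  have "2 * m \<le> m * (n + 1) + (m + 1) * n"
    using assms by (cases n) auto
  moreover have "vlabel m n q j \<le> 2 * m" "1 \<le> vlabel m n q j"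
    using True assms by (auto simp: vlabel_def)
  ultimately show ?thesis by simp
next
  case False
  then show ?thesis using block_le[OF \<open>q < m\<close>, of "n - 1"] assms
    by (cases n) (auto simp: vlabel_def)
qed

lemma vlabel_inject:
  assumes "q < m" "q' < m" "j \<le> n" "j' \<le> n" "1 \<le> n" and eq: "vlabel m n q j = vlabel m n q' j'"
  shows "q = q' \<and> j = j'"
proof -
  have "2 * m \<le> 2 * m + (m + 1) * n" by simp
  then have outer: "(j = 0 \<or> j = n) \<longleftrightarrow> (j' = 0 \<or> j' = n)"
    using vlabel_outer_le[of q m j n] vlabel_outer_le[of q' m j' n]
      vlabel_inner_gt[of j n m q] vlabel_inner_gt[of j' n m q'] assms by fastforce
  show ?thesis
  proof (cases "j = 0 \<or> j = n")
    case True
    \<comment> \<open>The parity of an outer label tells the left column from the right one.\<close>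
    with outer assms show ?thesis by (auto simp: vlabel_def split: if_splits; presburger)
  next
    case False
    with outer have inner: "0 < j" "j < n" "0 < j'" "j' < n" using assms by auto
    then have "q = q'"
      using vlabel_inner_mono[of q q' j n j' m] vlabel_inner_mono[of q' q j' n j m] eq
      by (cases q q' rule: linorder_cases) auto
    with inner eq show ?thesis by (auto simp: vlabel_def split: if_splits)
  qed
qed

lemma hlabel_bounds:
  assumes "t \<le> m" "j < n"
  shows "2 * m < hlabel m n t j" "hlabel m n t j \<le> 2 * m + (m + 1) * n"
proof -
  have "t * n + n \<le> (m + 1) * n"
    using block_le[of t "m + 1" n] assms by linarith
  with \<open>j < n\<close> show "2 * m < hlabel m n t j" "hlabel m n t j \<le> 2 * m + (m + 1) * n"
    unfolding hlabel_def by linarith+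
qed

lemma hlabel_inject:
  assumes "j < n" "j' < n" "hlabel m n t j = hlabel m n t' j'"
  shows "t = t' \<and> j = j'"
  using hlabel_mono[of t t' j n m j'] hlabel_mono[of t' t j' n m j] assms
  by (cases t t' rule: linorder_cases) (auto simp: hlabel_def)

lemma vlabel_neq_hlabel:
  assumes "q < m" "j \<le> n" "t \<le> m" "j' < n"
  shows "vlabel m n q j \<noteq> hlabel m n t j'"
  using vlabel_outer_le[of q m j n] vlabel_inner_gt[of j n m q] hlabel_bounds[of t m j' n] assms
  by (cases "j = 0 \<or> j = n") auto

section \<open>Comparison of vertex sums\<close>

lemma pos_sum_left_right:
  assumes "1 \<le> n"
  shows "pos_sum m n t 0 < pos_sum m n t n"
  using assms by (auto simp: pos_sum_def layer_sum_def vlabel_def hlabel_def)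

text \<open>Strictness comes from the horizontal labels. The vertical parts are equal for
  \<open>t = m - 1\<close> and \<open>t' = m\<close>, where the two rows share a layer.\<close>

lemma pos_sum_right_left:
  assumes "1 \<le> n" "2 \<le> m" "t < t'" "t' \<le> m"
  shows "pos_sum m n t n < pos_sum m n t' 0"
  using block_le[OF \<open>t < t'\<close>, of n] assms
  by (auto simp: pos_sum_def layer_sum_def vlabel_def hlabel_def)

text \<open>An outer vertex meets at most two vertical labels up to \<open>2 * m\<close> and one
  horizontal label, in all at most \<open>6 * m + (m + 1) * n\<close>. At an inner vertex one
  vertical label exceeds \<open>2 * m + (m + 1) * n\<close>, and the two horizontal ones add more
  than \<open>4 * m\<close>.\<close>

lemma pos_sum_outer_inner:
  assumes "2 \<le> m" "t \<le> m" "t' \<le> m" "j = 0 \<or> j = n" "0 < j'" "j' < n"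
  shows "pos_sum m n t j < pos_sum m n t' j'"
proof -
  have "layer_sum m (\<lambda>q. vlabel m n q j) t \<le> 4 * m"
  proof -
    have "\<forall>q<m. vlabel m n q j \<le> 2 * m"
      using vlabel_outer_le assms by blast
    then have "vlabel m n t j + vlabel m n (t - 2) j \<le> 4 * m" if "t < m"
      using that by (simp add: add_mono[of _ "2 * m" _ "2 * m", simplified])
    moreover have "vlabel m n (m - 1) j + vlabel m n (m - 2) j \<le> 4 * m"
      using \<open>\<forall>q<m. _\<close> assms by (simp add: add_mono[of _ "2 * m" _ "2 * m", simplified])
    ultimately show ?thesis by (auto simp: layer_sum_def)
  qed
  moreover have "(if 0 < j then hlabel m n t (j - 1) else 0) + (if j < n then hlabel m n t j else 0)
      \<le> 2 * m + (m + 1) * n"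
    using hlabel_bounds(2)[OF \<open>t \<le> m\<close>, of 0 n] hlabel_bounds(2)[OF \<open>t \<le> m\<close>, of "n - 1" n] assms
    by auto
  ultimately have "pos_sum m n t j \<le> 6 * m + (m + 1) * n"
    by (simp add: pos_sum_def)
  also have "\<dots> < 2 * m + (m + 1) * n + (hlabel m n t' (j' - 1) + hlabel m n t' j')"
    by (simp add: hlabel_def)
  also have "\<dots> < pos_sum m n t' j'"
    using vlabel_inner_gt[of j' n m t'] vlabel_inner_gt[of j' n m "m - 1"] assms
    by (auto simp: pos_sum_def layer_sum_def)
  finally show ?thesis .
qed

text \<open>Expresses the reversal of the innermost layer without subtraction, so that linear
  arithmetic can weigh its loss against the horizontal gain.\<close>

lemma vlabel_last:
  assumes "0 < j" "j < n" "0 < j'" "j' < n"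
  shows "vlabel m n (m - 1) j + j = vlabel m n (m - 1) j' + j'"
  using assms by (simp add: vlabel_def)

text \<open>Per column, the two horizontal labels gain 2 in total and the reversed layer loses only
  1; all other layers increase.\<close>

lemma pos_sum_row_mono:
  assumes "2 \<le> m" "t \<le> m" "0 < j" "j < j'" "j' < n"
  shows "pos_sum m n t j < pos_sum m n t j'"
proof -
  have inc: "vlabel m n q j < vlabel m n q j'" if "q < m - 1" for q
    using that assms by (simp add: vlabel_def)
  have last: "vlabel m n (m - 1) j + j = vlabel m n (m - 1) j' + j'"
    by (rule vlabel_last) (use assms in simp_all)
  have h: "hlabel m n t (j - 1) + hlabel m n t j + 2 * j' =
      hlabel m n t (j' - 1) + hlabel m n t j' + 2 * j"
    using assms by (simp add: hlabel_def)
  consider "t < m - 1" | "t = m - 1" | "t = m" using assms by linarith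
  then show ?thesis
  proof cases
    case 1
    with inc[of t] inc[of "t - 2", OF less_imp_diff_less] h assms show ?thesis
      by (auto simp: pos_sum_def layer_sum_def)
  next
    case 2
    moreover have "vlabel m n (t - 2) j < vlabel m n (t - 2) j'"
      using inc 2 assms by simp
    ultimately show ?thesis using last h assms by (auto simp: pos_sum_def layer_sum_def)
  next
    case 3
    moreover have "vlabel m n (m - 2) j < vlabel m n (m - 2) j'"
      using inc assms by simp
    ultimately show ?thesis using last h assms by (auto simp: pos_sum_def layer_sum_def)
  qed
qed

lemma pos_sum_inner_mono:
  assumes "2 \<le> m" "t < t'" "t' \<le> m" "0 < j" "j < n" "0 < j'" "j' < n"
  shows "pos_sum m n t j < pos_sum m n t' j'"
proof -
  have v: "vlabel m n q j < vlabel m n q' j'" if "q < q'" for q q'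
    using vlabel_inner_mono that assms by simp
  have h: "hlabel m n t (j - 1) < hlabel m n t' (j' - 1)" "hlabel m n t j < hlabel m n t' j'"
    using hlabel_mono assms by simp_all
  consider "t' < m" | "t' = m" "t < m - 1" | "t' = m" "t = m - 1" using assms by linarith
  then show ?thesis
  proof cases
    case 1
    moreover have "vlabel m n (t - 2) j < vlabel m n (t' - 2) j'" if "2 \<le> t"
      using v[of "t - 2" "t' - 2"] that assms by simp
    ultimately show ?thesis using v[of t t'] h assms by (auto simp: pos_sum_def layer_sum_def)
  next
    case 2
    moreover have "vlabel m n (t - 2) j < vlabel m n (m - 2) j'" if "2 \<le> t"
      using v[of "t - 2" "m - 2"] that 2 assms by simp
    moreover have "vlabel m n t j < vlabel m n (m - 1) j'"
      using v 2 by simp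
    ultimately show ?thesis
      using h assms by (cases "2 \<le> t") (simp_all add: pos_sum_def layer_sum_def)
  next
    case 3
    \<comment> \<open>Both rows meet the innermost layer. With \<open>d = j' - j\<close> as an
      integer, the horizontal labels change by \<open>2 * n + 2 * d\<close> and the shared layer by
      \<open>- d\<close>, which leaves \<open>2 * n + d > 0\<close>. An increasing layer would give
      \<open>2 * n + 3 * d\<close>, possibly negative.\<close>
    have last: "vlabel m n (m - 1) j + j = vlabel m n (m - 1) j' + j'"
      by (rule vlabel_last) (use assms in simp_all)
    have "t' * n = t * n + n"
      using 3 assms by (cases m) auto
    then have "hlabel m n t (j - 1) + hlabel m n t j + 2 * n + 2 * j' =
        hlabel m n t' (j' - 1) + hlabel m n t' j' + 2 * j"
      using assms by (simp add: hlabel_def)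
    moreover have "vlabel m n (t - 2) j < vlabel m n (m - 2) j'" if "2 \<le> t"
      using v[of "t - 2" "m - 2"] that 3 by simp
    ultimately show ?thesis
      using 3 last assms by (cases "2 \<le> t") (auto simp: pos_sum_def layer_sum_def)
  qed
qed

text \<open>The sums are ordered lexicographically: outer columns before inner ones, then by
  position of the row, then by column.\<close>

lemma pos_sum_inject:
  assumes "1 \<le> n" "2 \<le> m" "t \<le> m" "t' \<le> m" "j \<le> n" "j' \<le> n"
    and eq: "pos_sum m n t j = pos_sum m n t' j'"
  shows "t = t' \<and> j = j'"
proof -
  have outer: "(j = 0 \<or> j = n) \<longleftrightarrow> (j' = 0 \<or> j' = n)"
    using pos_sum_outer_inner[of m t t' j n j'] pos_sum_outer_inner[of m t' t j' n j] assms
    by fastforce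
  have less: "pos_sum m n s i < pos_sum m n s' i'"
    if "s < s'" "s' \<le> m" "i \<le> n" "i' \<le> n" "(i = 0 \<or> i = n) \<longleftrightarrow> (i' = 0 \<or> i' = n)"
    for s s' i i'
  proof (cases "i = 0 \<or> i = n")
    case True
    \<comment> \<open>It suffices to compare the right end of the earlier row with the left end of
      the later one.\<close>
    then have "pos_sum m n s i \<le> pos_sum m n s n" "pos_sum m n s' 0 \<le> pos_sum m n s' i'"
      using that pos_sum_left_right[of n m s] pos_sum_left_right[of n m s'] assms by fastforce+
    with pos_sum_right_left[of n m s s'] that assms show ?thesis by simp
  next
    case False
    with pos_sum_inner_mono[of m s s' i n i'] that assms show ?thesis by auto
  qed
  have "t = t'"
    using less[of t t' j j'] less[of t' t j' j] outer assms
    by (cases t t' rule: linorder_cases) auto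
  moreover have "j = j'"
  proof (cases "j = 0 \<or> j = n")
    case True
    with outer eq \<open>t = t'\<close> pos_sum_left_right[of n m t] assms show ?thesis by auto
  next
    case False
    with outer eq \<open>t = t'\<close> pos_sum_row_mono[of m t j j' n] pos_sum_row_mono[of m t j' j n] assms
    show ?thesis by (cases j j' rule: linorder_cases) auto
  qed
  ultimately show ?thesis by simp
qed

section \<open>Assembly of the labeling, and the 4-cycle\<close>

lemma grid_labeling_outer_pos:
  assumes "2 \<le> m" "1 \<le> n"
  shows "grid_labeling m n (\<lambda>i. vlabel m n (outer_pos (m - 1) i)) (\<lambda>i. hlabel m n (outer_pos m i))"
    (is "grid_labeling m n ?a ?h")
proof -
  have sum: "grid_sum m n ?a ?h i j = pos_sum m n (outer_pos m i) j" if "i \<le> m" for i j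
    using layer_sum_outer_pos[of i m "\<lambda>q. vlabel m n q j"] that assms
    unfolding grid_sum_def pos_sum_def by simp
  have layer: "outer_pos (m - 1) i < m" if "i < m" for i
    using outer_pos_le[of i "m - 1"] that by linarith
  have layer_eq: "outer_pos (m - 1) i = outer_pos (m - 1) i' \<longleftrightarrow> i = i'"
    if "i < m" "i' < m" for i i'
    using outer_pos_eq_iff[of i "m - 1" i'] that by simp
  show ?thesis
  proof (unfold_locales, goal_cases)
    case (1 i j)
    then show ?case by (intro vlabel_bounds layer assms)
  next
    case (2 i j)
    \<comment> \<open>The horizontal labels end at \<open>2 * m + (m + 1) * n\<close>, which is
      within the number of edges because \<open>n\<close> is positive.\<close>
    have "m \<le> m * n" using assms by simp
    then have "2 * m \<le> m * (n + 1)" by simp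
    with hlabel_bounds[OF outer_pos_le[OF 2(1)] 2(2)] show ?case
      unfolding atLeastAtMost_iff by linarith
  next
    case (3 i j i' j')
    then show ?case
      using vlabel_inject[OF layer layer _ _ \<open>1 \<le> n\<close>] layer_eq by blast
  next
    case (4 i j i' j')
    then show ?case using hlabel_inject outer_pos_eq_iff by blast
  next
    case (5 i j i' j')
    then show ?case by (intro vlabel_neq_hlabel layer outer_pos_le)
  next
    case (6 i j i' j')
    then have "pos_sum m n (outer_pos m i) j = pos_sum m n (outer_pos m i') j'"
      using sum by simp
    with 6 have "outer_pos m i = outer_pos m i' \<and> j = j'"
      using assms by (intro pos_sum_inject[of n m] outer_pos_le)
    with 6 show ?case using outer_pos_eq_iff by blast
  qed
qed

text \<open>The vertex sums are 3 and 6 in row 0, and 4 and 7 in row 1.\<close>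

lemma grid_labeling_square:
  "grid_labeling 1 1 (\<lambda>i j. if j = 0 then 1 else 4) (\<lambda>i j. if i = 0 then 2 else 3)"
proof -
  have le: "k \<le> (1::nat) \<longleftrightarrow> k = 0 \<or> k = 1" for k by auto
  show ?thesis
    unfolding grid_labeling_def le less_one grid_sum_def
    by (intro conjI allI impI; elim disjE; simp)
qed

theorem theorem1p1:
  fixes m n :: nat
  assumes "m \<ge> 1" and "n \<ge> 1"
  shows "antimagic
           (cart_vertices (path_vertices (m + 1)) (path_vertices (n + 1)))
           (cart_edges (path_vertices (m + 1)) (path_edges (m + 1))
                       (path_vertices (n + 1)) (path_edges (n + 1)))"
proof -
  consider "2 \<le> m" | "2 \<le> n" | "m = 1" "n = 1" using assms by linarith
  then have "\<exists>a h. grid_labeling m n a h"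
  proof cases
    case 1
    then show ?thesis using grid_labeling_outer_pos assms by blast
  next
    case 2
    then show ?thesis using grid_labeling_swap[OF grid_labeling_outer_pos] assms by blast
  next
    case 3
    then show ?thesis using grid_labeling_square by blast
  qed
  then show ?thesis using grid_labeling.antimagic_grid by blast
qed

end
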